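(* Let $G$ be a compact group, and suppose that the free left-translation action of $G$ on $\prod_{\rho}U(\dim\rho)$ through the canonical embedding $$\mathrm{can}_G=\prod_\rho \rho: G\hookrightarrow \prod_{\rho}U(\dim \rho)$$ is principal (this is so, in particular, if every free continuous action of $G$ on a Tychonoff space is principal). Then: - the connected-component group $G/G_0$ and the group $\pi_0(G)$ of path components of $G$ are both finite, and they coincide; - $G_0$ is path-connected; - $G$ and $G_0$ are locally connected and locally path-connected.
   Context: Compact groups are compact Hausdorff topological groups; $G_0$ is the identity connected component of $G$. The product is over (representatives of the isomorphism classes of) irreducible unitary representations $\rho: G\to U(\dim\rho)$ of $G$, and $U(n)$ is the group of $n\times n$ unitary matrices. A free continuous action of $G$ on a Tychonoff space $X$ is principal if $X\to X/G$ is a locally trivial principal $G$-bundle, i.e. every point of $X/G$ has an open neighborhood $U$ whose preimage in $X$ is $G$-equivariantly homeomorphic over $U$ to $G\times U$. A space is locally (path-)connected if its topology has a basis of (path-)connected open sets. *)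

theory Defs
  imports
    "HOL-Analysis.Analysis"
    "HOL-Algebra.Group_Action"
    "HOL-Algebra.Product_Groups"
    "Jordan_Normal_Form.Schur_Decomposition"
    "Jordan_Normal_Form.VS_Connect"
begin

section \<open>Compact groups\<close>

definition topological_group :: "('a, 'm) monoid_scheme \<Rightarrow> 'a topology \<Rightarrow> bool" where
  "topological_group G T \<longleftrightarrow>
     group G \<and> topspace T = carrier G \<and>
     continuous_map (prod_topology T T) T (\<lambda>(x, y). x \<otimes>\<^bsub>G\<^esub> y) \<and>
     continuous_map T T (\<lambda>x. inv\<^bsub>G\<^esub> x)"

definition compact_group :: "('a, 'm) monoid_scheme \<Rightarrow> 'a topology \<Rightarrow> bool" where
  "compact_group G T \<longleftrightarrow> topological_group G T \<and> compact_space T \<and> Hausdorff_space T"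

definition identity_component :: "('a, 'm) monoid_scheme \<Rightarrow> 'a topology \<Rightarrow> 'a set" where
  "identity_component G T = connected_component_of_set T \<one>\<^bsub>G\<^esub>"

text \<open>
  The path components of a topological group form a group under the product of subsets:
  the product of the path components of \<open>x\<close> and \<open>y\<close> is that of \<open>x \<otimes> y\<close>, see lemma
  \<open>path_component_set_mult\<close> below. The quotient \<open>G Mod H\<close> of the library has the same kind of
  elements (subsets of \<open>G\<close>) and the same multiplication, so the two can be compared by equality.
\<close>
definition path_component_group :: "('a, 'm) monoid_scheme \<Rightarrow> 'a topology \<Rightarrow> 'a set monoid" where
  "path_component_group G T =
     \<lparr>carrier = path_components_of T,
      monoid.mult = set_mult G,
      one = path_component_of_set T \<one>\<^bsub>G\<^esub>\<rparr>"


section \<open>Principal actions\<close>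

definition tychonoff_space :: "'x topology \<Rightarrow> bool" where
  "tychonoff_space X \<longleftrightarrow> completely_regular_space X \<and> Hausdorff_space X"

definition free_continuous_action ::
    "('a, 'm) monoid_scheme \<Rightarrow> 'a topology \<Rightarrow> 'x topology \<Rightarrow> ('a \<Rightarrow> 'x \<Rightarrow> 'x) \<Rightarrow> bool" where
  "free_continuous_action G T X \<phi> \<longleftrightarrow>
     group_action G (topspace X) \<phi> \<and>
     continuous_map (prod_topology T X) X (\<lambda>(g, x). \<phi> g x) \<and>
     (\<forall>x \<in> topspace X. stabilizer G \<phi> x = {\<one>\<^bsub>G\<^esub>})"

definition orbit_space ::
    "('a, 'm) monoid_scheme \<Rightarrow> 'x topology \<Rightarrow> ('a \<Rightarrow> 'x \<Rightarrow> 'x) \<Rightarrow> 'x set topology" where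
  "orbit_space G X \<phi> =
     topology (\<lambda>U. U \<subseteq> orbits G (topspace X) \<phi> \<and> openin X {x \<in> topspace X. orbit G \<phi> x \<in> U})"

text \<open>
  The map \<open>h\<close> is the trivialization: its second component is the orbit map (``over \<open>U\<close>''), and it
  intertwines the given action with left translation on the first factor.
\<close>
definition locally_trivial_action ::
    "('a, 'm) monoid_scheme \<Rightarrow> 'a topology \<Rightarrow> 'x topology \<Rightarrow> ('a \<Rightarrow> 'x \<Rightarrow> 'x) \<Rightarrow> bool" where
  "locally_trivial_action G T X \<phi> \<longleftrightarrow>
     (\<forall>p \<in> topspace (orbit_space G X \<phi>). \<exists>U h.
        openin (orbit_space G X \<phi>) U \<and> p \<in> U \<and>
        homeomorphic_map
          (subtopology X {x \<in> topspace X. orbit G \<phi> x \<in> U})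
          (prod_topology T (subtopology (orbit_space G X \<phi>) U)) h \<and>
        (\<forall>x \<in> topspace X. orbit G \<phi> x \<in> U \<longrightarrow>
           snd (h x) = orbit G \<phi> x \<and>
           (\<forall>g \<in> carrier G. h (\<phi> g x) = (g \<otimes>\<^bsub>G\<^esub> fst (h x), snd (h x)))))"

definition principal_action ::
    "('a, 'm) monoid_scheme \<Rightarrow> 'a topology \<Rightarrow> 'x topology \<Rightarrow> ('a \<Rightarrow> 'x \<Rightarrow> 'x) \<Rightarrow> bool" where
  "principal_action G T X \<phi> \<longleftrightarrow>
     tychonoff_space X \<and> free_continuous_action G T X \<phi> \<and> locally_trivial_action G T X \<phi>"

definition left_translation ::
    "('b, 'n) monoid_scheme \<Rightarrow> ('a \<Rightarrow> 'b) \<Rightarrow> 'a \<Rightarrow> 'b \<Rightarrow> 'b" where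
  "left_translation H f = (\<lambda>g. \<lambda>x \<in> carrier H. f g \<otimes>\<^bsub>H\<^esub> x)"


section \<open>Unitary groups and unitary representations\<close>

definition unitary_group :: "nat \<Rightarrow> complex mat monoid" where
  "unitary_group n =
     \<lparr>carrier = {A \<in> carrier_mat n n. A * mat_adjoint A = 1\<^sub>m n \<and> mat_adjoint A * A = 1\<^sub>m n},
      monoid.mult = (*),
      one = 1\<^sub>m n\<rparr>"

text \<open>The topology of entrywise convergence, that is, the subspace topology of \<open>\<complex>\<^sup>n\<^sup>\<times>\<^sup>n\<close>.\<close>
definition unitary_topology :: "nat \<Rightarrow> complex mat topology" where
  "unitary_topology n =
     pullback_topology (carrier (unitary_group n))
       (\<lambda>A. \<lambda>ij \<in> {..<n} \<times> {..<n}. A $$ ij)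
       (product_topology (\<lambda>_. euclidean) ({..<n} \<times> {..<n}))"

definition unitary_rep ::
    "('a, 'm) monoid_scheme \<Rightarrow> 'a topology \<Rightarrow> nat \<Rightarrow> ('a \<Rightarrow> complex mat) \<Rightarrow> bool" where
  "unitary_rep G T n \<rho> \<longleftrightarrow>
     \<rho> \<in> hom G (unitary_group n) \<and> continuous_map T (unitary_topology n) \<rho>"

definition rep_dim :: "('a, 'm) monoid_scheme \<Rightarrow> ('a \<Rightarrow> complex mat) \<Rightarrow> nat" where
  "rep_dim G \<rho> = dim_row (\<rho> \<one>\<^bsub>G\<^esub>)"

text \<open>Here \<open>subspace\<close> is the carrier-based notion for the vector space \<open>\<complex>\<^sup>n\<close> of column vectors.\<close>
definition irreducible_unitary_rep ::
    "('a, 'm) monoid_scheme \<Rightarrow> 'a topology \<Rightarrow> ('a \<Rightarrow> complex mat) \<Rightarrow> bool" where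
  "irreducible_unitary_rep G T \<rho> \<longleftrightarrow>
     unitary_rep G T (rep_dim G \<rho>) \<rho> \<and> rep_dim G \<rho> > 0 \<and>
     (\<forall>W. VectorSpace.subspace class_ring W (module_vec TYPE(complex) (rep_dim G \<rho>)) \<and>
          (\<forall>g \<in> carrier G. \<forall>w \<in> W. \<rho> g *\<^sub>v w \<in> W) \<longrightarrow>
          W = {0\<^sub>v (rep_dim G \<rho>)} \<or> W = carrier_vec (rep_dim G \<rho>))"

definition rep_isomorphic ::
    "('a, 'm) monoid_scheme \<Rightarrow> ('a \<Rightarrow> complex mat) \<Rightarrow> ('a \<Rightarrow> complex mat) \<Rightarrow> bool" where
  "rep_isomorphic G \<rho> \<sigma> \<longleftrightarrow>
     rep_dim G \<rho> = rep_dim G \<sigma> \<and>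
     (\<exists>A \<in> carrier (unitary_group (rep_dim G \<rho>)). \<forall>g \<in> carrier G. A * \<rho> g = \<sigma> g * A)"

definition irrep_representatives ::
    "('a, 'm) monoid_scheme \<Rightarrow> 'a topology \<Rightarrow> ('a \<Rightarrow> complex mat) set \<Rightarrow> bool" where
  "irrep_representatives G T R \<longleftrightarrow>
     (\<forall>\<rho> \<in> R. irreducible_unitary_rep G T \<rho>) \<and>
     (\<forall>\<rho>. irreducible_unitary_rep G T \<rho> \<longrightarrow> (\<exists>!\<sigma>. \<sigma> \<in> R \<and> rep_isomorphic G \<rho> \<sigma>))"

definition unitary_product ::
    "('a, 'm) monoid_scheme \<Rightarrow> ('a \<Rightarrow> complex mat) set \<Rightarrow> (('a \<Rightarrow> complex mat) \<Rightarrow> complex mat) monoid" where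
  "unitary_product G R = product_group R (\<lambda>\<rho>. unitary_group (rep_dim G \<rho>))"

definition unitary_product_topology ::
    "('a, 'm) monoid_scheme \<Rightarrow> ('a \<Rightarrow> complex mat) set \<Rightarrow> (('a \<Rightarrow> complex mat) \<Rightarrow> complex mat) topology" where
  "unitary_product_topology G R = product_topology (\<lambda>\<rho>. unitary_topology (rep_dim G \<rho>)) R"

definition canonical_embedding ::
    "('a \<Rightarrow> complex mat) set \<Rightarrow> 'a \<Rightarrow> ('a \<Rightarrow> complex mat) \<Rightarrow> complex mat" where
  "canonical_embedding R = (\<lambda>g. \<lambda>\<rho> \<in> R. \<rho> g)"


section \<open>Basic properties\<close>

lemma openin_orbit_space:
  "openin (orbit_space G X \<phi>) U \<longleftrightarrow>
     U \<subseteq> orbits G (topspace X) \<phi> \<and> openin X {x \<in> topspace X. orbit G \<phi> x \<in> U}"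
proof -
  have "istopology (\<lambda>U. U \<subseteq> orbits G (topspace X) \<phi> \<and> openin X {x \<in> topspace X. orbit G \<phi> x \<in> U})"
    unfolding istopology_def
  proof (intro conjI allI impI)
    fix S T
    assume S: "S \<subseteq> orbits G (topspace X) \<phi> \<and> openin X {x \<in> topspace X. orbit G \<phi> x \<in> S}"
      and T: "T \<subseteq> orbits G (topspace X) \<phi> \<and> openin X {x \<in> topspace X. orbit G \<phi> x \<in> T}"
    show "S \<inter> T \<subseteq> orbits G (topspace X) \<phi>" using S by blast
    have "{x \<in> topspace X. orbit G \<phi> x \<in> S \<inter> T} =
        {x \<in> topspace X. orbit G \<phi> x \<in> S} \<inter> {x \<in> topspace X. orbit G \<phi> x \<in> T}" by blast
    then show "openin X {x \<in> topspace X. orbit G \<phi> x \<in> S \<inter> T}"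
      using openin_Int[OF conjunct2[OF S] conjunct2[OF T]] by simp
  next
    fix K
    assume K: "\<forall>S\<in>K. S \<subseteq> orbits G (topspace X) \<phi> \<and> openin X {x \<in> topspace X. orbit G \<phi> x \<in> S}"
    show "\<Union>K \<subseteq> orbits G (topspace X) \<phi>" using K by blast
    have "{x \<in> topspace X. orbit G \<phi> x \<in> \<Union>K} = (\<Union>S\<in>K. {x \<in> topspace X. orbit G \<phi> x \<in> S})" by blast
    then show "openin X {x \<in> topspace X. orbit G \<phi> x \<in> \<Union>K}" using K by auto
  qed
  then show ?thesis by (simp add: orbit_space_def topology_inverse')
qed

lemma topspace_orbit_space: "topspace (orbit_space G X \<phi>) = orbits G (topspace X) \<phi>"
proof -
  have "{x \<in> topspace X. orbit G \<phi> x \<in> orbits G (topspace X) \<phi>} = topspace X"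
    by (auto simp: orbits_def)
  then have "openin (orbit_space G X \<phi>) (orbits G (topspace X) \<phi>)"
    by (simp add: openin_orbit_space)
  then show ?thesis
    by (meson openin_orbit_space openin_subset openin_topspace subset_antisym)
qed

lemma quotient_map_orbit: "quotient_map X (orbit_space G X \<phi>) (orbit G \<phi>)"
  by (auto simp: quotient_map_def topspace_orbit_space openin_orbit_space orbits_def)

lemma path_component_set_mult:
  assumes G: "topological_group G T" and x: "x \<in> carrier G" and y: "y \<in> carrier G"
  shows "path_component_of_set T x <#>\<^bsub>G\<^esub> path_component_of_set T y =
         path_component_of_set T (x \<otimes>\<^bsub>G\<^esub> y)"
proof -
  interpret group G using G by (simp add: topological_group_def)
  have ts: "topspace T = carrier G" 
    and cm: "continuous_map (prod_topology T T) T (\<lambda>(x, y). x \<otimes>\<^bsub>G\<^esub> y)"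
    using G by (auto simp: topological_group_def)
  have mul: "path_component_of T (a \<otimes>\<^bsub>G\<^esub> b) (a' \<otimes>\<^bsub>G\<^esub> b')"
    if ab: "path_component_of T a a'" "path_component_of T b b'" for a a' b b'
  proof -
    obtain p q where pq: "pathin T p" "p 0 = a" "p 1 = a'" "pathin T q" "q 0 = b" "q 1 = b'"
      using ab unfolding path_component_of_def by blast
    have "continuous_map (top_of_set {0..1}) (prod_topology T T) (\<lambda>t. (p t, q t))"
      using pq by (simp add: pathin_def continuous_map_pairedI)
    from continuous_map_compose[OF this cm] have "pathin T (\<lambda>t. p t \<otimes>\<^bsub>G\<^esub> q t)"
      by (simp add: pathin_def o_def)
    then show ?thesis unfolding path_component_of_def using pq
      by (intro exI[of _ "\<lambda>t. p t \<otimes>\<^bsub>G\<^esub> q t"]) auto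
  qed
  have sub: "z \<in> carrier G" if "path_component_of T w z" for w z
    using that ts path_component_in_topspace by metis
  show ?thesis
  proof (intro equalityI subsetI)
    fix z assume "z \<in> path_component_of_set T x <#>\<^bsub>G\<^esub> path_component_of_set T y"
    then show "z \<in> path_component_of_set T (x \<otimes>\<^bsub>G\<^esub> y)" by (auto simp: set_mult_def intro: mul)
  next
    fix z assume "z \<in> path_component_of_set T (x \<otimes>\<^bsub>G\<^esub> y)"
    then have z: "path_component_of T (x \<otimes>\<^bsub>G\<^esub> y) z" by simp
    have zc: "z \<in> carrier G" using sub z by blast
    have yy: "path_component_of T y y" and ii: "path_component_of T (inv\<^bsub>G\<^esub> y) (inv\<^bsub>G\<^esub> y)"
      using y ts by (auto simp: path_component_of_refl)
    have "path_component_of T (x \<otimes>\<^bsub>G\<^esub> y \<otimes>\<^bsub>G\<^esub> inv\<^bsub>G\<^esub> y) (z \<otimes>\<^bsub>G\<^esub> inv\<^bsub>G\<^esub> y)"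
      by (rule mul[OF z ii])
    then have "path_component_of T x (z \<otimes>\<^bsub>G\<^esub> inv\<^bsub>G\<^esub> y)" using x y by (simp add: m_assoc)
    moreover have "z = (z \<otimes>\<^bsub>G\<^esub> inv\<^bsub>G\<^esub> y) \<otimes>\<^bsub>G\<^esub> y" using zc y by (simp add: m_assoc)
    ultimately show "z \<in> path_component_of_set T x <#>\<^bsub>G\<^esub> path_component_of_set T y"
      using yy unfolding set_mult_def by blast
  qed
qed


lemma index_mat_adjoint:
  "i < dim_col A \<Longrightarrow> j < dim_row A \<Longrightarrow> mat_adjoint A $$ (i, j) = conjugate (A $$ (j, i))"
  by (simp add: mat_adjoint_def mat_of_rows_def)

lemma dim_mat_adjoint [simp]: "dim_row (mat_adjoint A) = dim_col A" "dim_col (mat_adjoint A) = dim_row A"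
  by (simp_all add: mat_adjoint_def mat_of_rows_def)

lemma mat_adjoint_carrier [simp]: "A \<in> carrier_mat n m \<Longrightarrow> mat_adjoint A \<in> carrier_mat m n"
  by (auto simp: mat_adjoint_def mat_of_rows_def)

lemma mat_adjoint_adjoint: 
  fixes A :: "complex mat" shows "mat_adjoint (mat_adjoint A) = A"
proof -
  have d: "mat_adjoint A \<in> carrier_mat (dim_col A) (dim_row A)" by simp
  show ?thesis
    by (rule eq_matI) (use d in \<open>auto simp: index_mat_adjoint mat_adjoint_def mat_of_rows_def\<close>)
qed

lemma mat_adjoint_mult:
  fixes A :: "complex mat"
  assumes A: "A \<in> carrier_mat n m" and B: "B \<in> carrier_mat m k"
  shows "mat_adjoint (A * B) = mat_adjoint B * mat_adjoint A"
proof (rule eq_matI)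
  have d: "mat_adjoint A \<in> carrier_mat m n" "mat_adjoint B \<in> carrier_mat k m"
    "mat_adjoint (A * B) \<in> carrier_mat k n" using A B by auto
  show "dim_row (mat_adjoint (A * B)) = dim_row (mat_adjoint B * mat_adjoint A)"
    "dim_col (mat_adjoint (A * B)) = dim_col (mat_adjoint B * mat_adjoint A)" using d by auto
  fix i j assume "i < dim_row (mat_adjoint B * mat_adjoint A)" "j < dim_col (mat_adjoint B * mat_adjoint A)"
  then have ij: "i < k" "j < n" using d by auto
  have "mat_adjoint (A * B) $$ (i, j) = cnj (\<Sum>l = 0..<m. A $$ (j, l) * B $$ (l, i))"
    using ij A B by (simp add: index_mat_adjoint scalar_prod_def)
  also have "\<dots> = (\<Sum>l = 0..<m. mat_adjoint B $$ (i, l) * mat_adjoint A $$ (l, j))"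
    using ij A B by (simp add: index_mat_adjoint mult.commute)
  also have "\<dots> = (mat_adjoint B * mat_adjoint A) $$ (i, j)"
    using ij A B by (simp add: scalar_prod_def)
  finally show "mat_adjoint (A * B) $$ (i, j) = (mat_adjoint B * mat_adjoint A) $$ (i, j)" .
qed

lemma group_unitary_group: "group (unitary_group n)"
proof (rule groupI)
  fix A B assume "A \<in> carrier (unitary_group n)" "B \<in> carrier (unitary_group n)"
  then have A: "A \<in> carrier_mat n n" "A * mat_adjoint A = 1\<^sub>m n" "mat_adjoint A * A = 1\<^sub>m n"
    and B: "B \<in> carrier_mat n n" "B * mat_adjoint B = 1\<^sub>m n" "mat_adjoint B * B = 1\<^sub>m n"
    by (auto simp: unitary_group_def)
  have a: "mat_adjoint A \<in> carrier_mat n n" "mat_adjoint B \<in> carrier_mat n n" using A B by auto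
  have ab: "A * B \<in> carrier_mat n n" "mat_adjoint B * mat_adjoint A \<in> carrier_mat n n"
    "mat_adjoint A * A \<in> carrier_mat n n" "B * mat_adjoint B \<in> carrier_mat n n" using A B a by auto
  have "A * B * (mat_adjoint B * mat_adjoint A) = A * (B * mat_adjoint B) * mat_adjoint A"
    using A(1) B(1) a ab by (simp add: assoc_mult_mat[of _ n n _ n _ n] del: mat_adjoint_carrier)
  moreover have "mat_adjoint B * mat_adjoint A * (A * B) = mat_adjoint B * (mat_adjoint A * A) * B"
    using A(1) B(1) a ab by (simp add: assoc_mult_mat[of _ n n _ n _ n] del: mat_adjoint_carrier)
  ultimately show "A \<otimes>\<^bsub>unitary_group n\<^esub> B \<in> carrier (unitary_group n)"
    using A B a by (simp add: unitary_group_def mat_adjoint_mult[OF A(1) B(1)])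
next
  have "mat_adjoint (1\<^sub>m n) = (1\<^sub>m n :: complex mat)"
    by (rule eq_matI) (auto simp: index_mat_adjoint mat_adjoint_def mat_of_rows_def)
  then show "\<one>\<^bsub>unitary_group n\<^esub> \<in> carrier (unitary_group n)" by (simp add: unitary_group_def)
next
  fix A assume "A \<in> carrier (unitary_group n)"
  then show "\<exists>B\<in>carrier (unitary_group n). B \<otimes>\<^bsub>unitary_group n\<^esub> A = \<one>\<^bsub>unitary_group n\<^esub>"
    by (intro bexI[of _ "mat_adjoint A"]) (auto simp: unitary_group_def mat_adjoint_adjoint)
qed (auto simp: unitary_group_def)

lemma topspace_unitary_topology: "topspace (unitary_topology n) = carrier (unitary_group n)"
  by (auto simp: unitary_topology_def topspace_pullback_topology)

lemma continuous_map_unitary_entry: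
  assumes "i < n" "j < n"
  shows "continuous_map (unitary_topology n) euclidean (\<lambda>A. A $$ (i, j))"
proof -
  have "continuous_map (product_topology (\<lambda>_. euclidean) ({..<n} \<times> {..<n})) euclidean (\<lambda>f. f (i, j) :: complex)"
    using assms by (intro continuous_map_product_projection) auto
  from continuous_map_pullback[OF this, of "carrier (unitary_group n)" "\<lambda>A. \<lambda>ij \<in> {..<n} \<times> {..<n}. A $$ ij"]
  show ?thesis using assms by (simp add: unitary_topology_def o_def)
qed

lemma continuous_map_into_unitary:
  assumes "f \<in> topspace X \<rightarrow> carrier (unitary_group n)"
    and "\<And>i j. i < n \<Longrightarrow> j < n \<Longrightarrow> continuous_map X euclidean (\<lambda>x. f x $$ (i, j))"
  shows "continuous_map X (unitary_topology n) f"
  unfolding unitary_topology_def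
proof (rule continuous_map_pullback')
  show "continuous_map X (product_topology (\<lambda>_. euclidean) ({..<n} \<times> {..<n}))
      ((\<lambda>A. \<lambda>ij \<in> {..<n} \<times> {..<n}. A $$ ij) \<circ> f)"
    using assms(2) by (auto simp: continuous_map_componentwise)
qed (use assms(1) in auto)

lemma continuous_map_unitary_mult:
  "continuous_map (prod_topology (unitary_topology n) (unitary_topology n)) (unitary_topology n)
     (\<lambda>(A, B). A * B)"
proof (rule continuous_map_into_unitary)
  show "(\<lambda>(A, B). A * B) \<in> topspace (prod_topology (unitary_topology n) (unitary_topology n))
      \<rightarrow> carrier (unitary_group n)"
    using group.is_monoid[OF group_unitary_group[of n], THEN monoid.m_closed]
    by (auto simp: topspace_unitary_topology) (simp add: unitary_group_def)
next
  fix i j assume ij: "i < n" "j < n"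
  let ?P = "prod_topology (unitary_topology n) (unitary_topology n)"
  have prod: "continuous_map ?P euclidean (\<lambda>p. fst p $$ (i, k) * snd p $$ (k, j))" if k: "k < n" for k
  proof -
    have "continuous_map ?P (prod_topology euclidean euclidean) (\<lambda>p. (fst p $$ (i, k), snd p $$ (k, j)))"
      using continuous_map_compose[OF continuous_map_fst continuous_map_unitary_entry[OF ij(1) k]]
        continuous_map_compose[OF continuous_map_snd continuous_map_unitary_entry[OF k ij(2)]]
      by (intro continuous_map_pairedI) (auto simp: o_def)
    moreover have "continuous_map (prod_topology euclidean euclidean) euclidean (\<lambda>(a, b). a * b :: complex)"
      by (simp add: case_prod_unfold continuous_intros)
    ultimately have "continuous_map ?P euclidean ((\<lambda>(a, b). a * b) \<circ> (\<lambda>p. (fst p $$ (i, k), snd p $$ (k, j))))"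
      by (rule continuous_map_compose)
    then show ?thesis by (simp add: o_def)
  qed
  have "continuous_map ?P euclidean (\<lambda>p. \<Sum>k\<in>{..<n}. fst p $$ (i, k) * snd p $$ (k, j))"
    by (rule continuous_map_sum) (auto intro: prod)
  then show "continuous_map ?P euclidean (\<lambda>p. (case p of (A, B) \<Rightarrow> A * B) $$ (i, j))"
    by (rule continuous_map_eq)
      (use ij in \<open>auto simp: topspace_unitary_topology unitary_group_def scalar_prod_def atLeast0LessThan\<close>)
qed

lemma tychonoff_unitary_topology: "tychonoff_space (unitary_topology n)"
proof -
  let ?f = "\<lambda>A :: complex mat. \<lambda>ij \<in> {..<n} \<times> {..<n}. A $$ ij"
  let ?P = "product_topology (\<lambda>_. euclidean :: complex topology) ({..<n} \<times> {..<n})"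
  have P: "completely_regular_space ?P" "Hausdorff_space ?P"
    by (auto simp: completely_regular_space_product_topology Hausdorff_space_product_topology
        intro!: metrizable_imp_completely_regular_space metrizable_space_euclidean)
  have f: "continuous_map (unitary_topology n) ?P ?f"
    unfolding continuous_map_componentwise
    by (auto intro: continuous_map_unitary_entry)
  have inj: "inj_on ?f (topspace (unitary_topology n))"
  proof (rule inj_onI)
    fix A B assume AB: "A \<in> topspace (unitary_topology n)" "B \<in> topspace (unitary_topology n)" "?f A = ?f B"
    have "A $$ (i, j) = B $$ (i, j)" if "i < n" "j < n" for i j
      using fun_cong[OF AB(3), of "(i, j)"] that by simp
    then show "A = B" using AB(1,2) by (intro eq_matI) (auto simp: topspace_unitary_topology unitary_group_def)
  qed
  have H: "Hausdorff_space (unitary_topology n)"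
    using Hausdorff_space_injective_preimage[OF P(2) f inj] .
  have "completely_regular_space (unitary_topology n)"
    unfolding completely_regular_space_def
  proof (intro allI impI, elim conjE)
    fix S x assume S: "closedin (unitary_topology n) S" and x: "x \<in> topspace (unitary_topology n) - S"
    have "openin (unitary_topology n) (topspace (unitary_topology n) - S)" using S by blast
    then obtain U where U: "openin ?P U" "topspace (unitary_topology n) - S = ?f -` U \<inter> carrier (unitary_group n)"
      unfolding unitary_topology_def openin_pullback_topology by blast
    have fx: "?f x \<in> U" "?f x \<in> topspace ?P" using x U(2) by blast auto
    have "closedin ?P (topspace ?P - U)" using U(1) by blast
    moreover have "?f x \<in> topspace ?P - (topspace ?P - U)" using fx by blast
    ultimately obtain g where g: "continuous_map ?P (top_of_set {0..1::real}) g" "g (?f x) = 0"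
        "g ` (topspace ?P - U) \<subseteq> {1}"
      using P(1) unfolding completely_regular_space_def by meson
    have "g (?f y) = 1" if y: "y \<in> S" for y
    proof -
      have "y \<in> carrier (unitary_group n)" using S y closedin_subset topspace_unitary_topology by blast
      then have "?f y \<notin> U" using U(2) y by blast
      moreover have "?f y \<in> topspace ?P" by auto
      ultimately show ?thesis using g(3) by blast
    qed
    then show "\<exists>g. continuous_map (unitary_topology n) (top_of_set {0..1::real}) g \<and> g x = 0 \<and> g ` S \<subseteq> {1}"
      using continuous_map_compose[OF f g(1)] g(2) by (intro exI[of _ "g \<circ> ?f"]) auto
  qed
  with H show ?thesis by (simp add: tychonoff_space_def)
qed

text \<open>
  If the canonical map is injective (which holds for every compact group, by the Peter--Weyl
  theorem), then it makes \<open>G\<close> act freely and continuously on a Tychonoff space.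
\<close>
lemma free_continuous_action_canonical:
  assumes G: "topological_group G T"
    and R: "\<And>\<rho>. \<rho> \<in> R \<Longrightarrow> unitary_rep G T (rep_dim G \<rho>) \<rho>"
    and inj: "inj_on (canonical_embedding R) (carrier G)"
  shows "tychonoff_space (unitary_product_topology G R)"
    and "free_continuous_action G T (unitary_product_topology G R)
           (left_translation (unitary_product G R) (canonical_embedding R))"
proof -
  let ?U = "\<lambda>\<rho>. unitary_group (rep_dim G \<rho>)"
  let ?H = "unitary_product G R" and ?X = "unitary_product_topology G R"
  let ?c = "canonical_embedding R"
  let ?\<phi> = "left_translation ?H ?c"
  show "tychonoff_space ?X"
    using tychonoff_unitary_topology
    by (auto simp: tychonoff_space_def unitary_product_topology_def
        completely_regular_space_product_topology Hausdorff_space_product_topology)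
  interpret G: group G using G by (simp add: topological_group_def)
  interpret H: group ?H unfolding unitary_product_def by (simp add: group_unitary_group)
  have ts: "topspace ?X = carrier ?H"
    by (simp add: unitary_product_topology_def unitary_product_def topspace_unitary_topology)
  have tsT: "topspace T = carrier G" using G by (simp add: topological_group_def)
  have hom: "\<rho> \<in> hom G (?U \<rho>)" and cont: "continuous_map T (unitary_topology (rep_dim G \<rho>)) \<rho>"
    if "\<rho> \<in> R" for \<rho> using R[OF that] by (auto simp: unitary_rep_def)
  have c_hom: "?c \<in> hom G ?H"
    using hom by (auto simp: hom_def canonical_embedding_def unitary_product_def Pi_iff fun_eq_iff)
  then have c_in: "?c g \<in> carrier ?H" if "g \<in> carrier G" for g using that by (auto simp: hom_def)
  have c_mult: "?c (g \<otimes>\<^bsub>G\<^esub> h) = ?c g \<otimes>\<^bsub>?H\<^esub> ?c h" if "g \<in> carrier G" "h \<in> carrier G" for g h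
    using c_hom that by (simp add: hom_mult)
  have c_one: "?c \<one>\<^bsub>G\<^esub> = \<one>\<^bsub>?H\<^esub>" using c_hom by (simp add: hom_one G.is_group H.is_group)
  have bij: "?\<phi> g \<in> Bij (carrier ?H)" if g: "g \<in> carrier G" for g
  proof -
    have "bij_betw (\<lambda>x. ?c g \<otimes>\<^bsub>?H\<^esub> x) (carrier ?H) (carrier ?H)"
    proof (rule bij_betw_byWitness[where f' = "\<lambda>x. inv\<^bsub>?H\<^esub> ?c g \<otimes>\<^bsub>?H\<^esub> x"])
    qed (use c_in[OF g] in \<open>auto simp flip: H.m_assoc\<close>)
    then show ?thesis
      by (simp add: Bij_def left_translation_def bij_betw_restrict_eq)
  qed
  have act: "group_action G (carrier ?H) ?\<phi>"
  proof (unfold group_action_def, rule group_hom.intro)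
    show "group (BijGroup (carrier ?H))" by (rule group_BijGroup)
    show "group_hom_axioms G (BijGroup (carrier ?H)) ?\<phi>"
    proof (unfold group_hom_axioms_def hom_def, intro CollectI conjI ballI)
      show "?\<phi> \<in> carrier G \<rightarrow> carrier (BijGroup (carrier ?H))" using bij by (auto simp: BijGroup_def)
      fix g h assume gh: "g \<in> carrier G" "h \<in> carrier G"
      have "?\<phi> (g \<otimes>\<^bsub>G\<^esub> h) = compose (carrier ?H) (?\<phi> g) (?\<phi> h)"
        using gh c_in by (auto simp: left_translation_def compose_def c_mult H.m_assoc fun_eq_iff)
      then show "?\<phi> (g \<otimes>\<^bsub>G\<^esub> h) = ?\<phi> g \<otimes>\<^bsub>BijGroup (carrier ?H)\<^esub> ?\<phi> h"
        using bij gh by (simp add: BijGroup_def)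
    qed
  qed (rule G.is_group)
  have free: "stabilizer G ?\<phi> x = {\<one>\<^bsub>G\<^esub>}" if x: "x \<in> carrier ?H" for x
  proof -
    have "g = \<one>\<^bsub>G\<^esub>" if g: "g \<in> carrier G" "?\<phi> g x = x" for g
    proof -
      have "?c g = ?c \<one>\<^bsub>G\<^esub>" using g x c_in[OF g(1)] by (simp add: left_translation_def c_one)
      then show ?thesis using inj g(1) by (auto dest: inj_onD)
    qed
    then show ?thesis using x by (auto simp: stabilizer_def left_translation_def c_one)
  qed
  have cm: "continuous_map (prod_topology T ?X) ?X (\<lambda>(g, x). ?\<phi> g x)"
  proof -
    have comp: "continuous_map (prod_topology T ?X) (unitary_topology (rep_dim G \<rho>))
        (\<lambda>p. \<rho> (fst p) * snd p \<rho>)" if \<rho>: "\<rho> \<in> R" for \<rho>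
    proof -
      have pr: "continuous_map ?X (unitary_topology (rep_dim G \<rho>)) (\<lambda>x. x \<rho>)"
        unfolding unitary_product_topology_def using \<rho> by (rule continuous_map_product_projection)
      have "continuous_map (prod_topology T ?X)
          (prod_topology (unitary_topology (rep_dim G \<rho>)) (unitary_topology (rep_dim G \<rho>)))
          (\<lambda>p. (\<rho> (fst p), snd p \<rho>))"
        using continuous_map_compose[OF continuous_map_fst cont[OF \<rho>], of ?X]
          continuous_map_compose[OF continuous_map_snd pr, of T]
        by (intro continuous_map_pairedI) (simp_all add: o_def)
      from continuous_map_compose[OF this continuous_map_unitary_mult] show ?thesis by (simp add: o_def)
    qed
    have "continuous_map (prod_topology T ?X) (product_topology (\<lambda>\<rho>. unitary_topology (rep_dim G \<rho>)) R)
        (\<lambda>p. \<lambda>\<rho>\<in>R. \<rho> (fst p) * snd p \<rho>)"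
      unfolding continuous_map_componentwise
    proof (intro conjI ballI)
      fix \<rho> assume \<rho>: "\<rho> \<in> R"
      show "continuous_map (prod_topology T ?X) (unitary_topology (rep_dim G \<rho>))
          (\<lambda>p. (\<lambda>\<rho>\<in>R. \<rho> (fst p) * snd p \<rho>) \<rho>)"
        using comp[OF \<rho>] \<rho> by simp
    qed auto
    then have cm0: "continuous_map (prod_topology T ?X) ?X (\<lambda>p. \<lambda>\<rho>\<in>R. \<rho> (fst p) * snd p \<rho>)"
      by (simp only: unitary_product_topology_def)
    have eq: "(\<lambda>\<rho>\<in>R. \<rho> (fst p) * snd p \<rho>) = (\<lambda>(g, x). ?\<phi> g x) p"
      if "p \<in> topspace (prod_topology T ?X)" for p
    proof -
      have p: "snd p \<in> carrier ?H" using that by (simp add: ts mem_Times_iff)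
      have "?\<phi> (fst p) (snd p) = (\<lambda>\<rho>\<in>R. ?c (fst p) \<rho> \<otimes>\<^bsub>?U \<rho>\<^esub> snd p \<rho>)"
        using p by (simp add: left_translation_def) (simp add: unitary_product_def)
      also have "\<dots> = (\<lambda>\<rho>\<in>R. \<rho> (fst p) * snd p \<rho>)"
        by (rule restrict_ext) (simp add: canonical_embedding_def unitary_group_def)
      finally show ?thesis by (simp add: case_prod_unfold)
    qed
    show ?thesis by (rule continuous_map_eq[OF cm0 eq])
  qed
  show "free_continuous_action G T ?X ?\<phi>"
    unfolding free_continuous_action_def using act free cm by (simp add: ts)
qed

corollary principal_action_canonical:
  fixes G :: "('a, 'm) monoid_scheme"
  assumes "compact_group G T" and "irrep_representatives G T R"
    and "inj_on (canonical_embedding R) (carrier G)"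
    and "\<And>(X :: (('a \<Rightarrow> complex mat) \<Rightarrow> complex mat) topology) \<phi>.
           tychonoff_space X \<Longrightarrow> free_continuous_action G T X \<phi> \<Longrightarrow> principal_action G T X \<phi>"
  shows "principal_action G T (unitary_product_topology G R)
           (left_translation (unitary_product G R) (canonical_embedding R))"
proof -
  have G: "topological_group G T" using assms(1) by (simp add: compact_group_def)
  have R: "unitary_rep G T (rep_dim G \<rho>) \<rho>" if "\<rho> \<in> R" for \<rho>
    using assms(2) that by (auto simp: irrep_representatives_def irreducible_unitary_rep_def)
  show ?thesis
    using free_continuous_action_canonical[OF G R assms(3)] by (rule assms(4))
qed

end

theory Submission
  imports Defs "Jordan_Normal_Form.Spectral_Radius"
begin

text \<open>
  The path \<open>t \<mapsto> ((1 + t) A + (1 - t)) ((1 - t) A + (1 + t))\<^sup>-\<^sup>1\<close>, which is linear in the Cayley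
  chart, joins \<open>1\<close> to \<open>A\<close> in \<open>U(n)\<close> whenever \<open>-1\<close> is not an eigenvalue of \<open>A\<close>, depends
  continuously on \<open>A\<close> and is constant for \<open>A = 1\<close>. So \<open>U(n)\<close> is locally path-connected; it is
  path-connected because every unitary matrix can be rotated by a scalar of modulus \<open>1\<close> into the
  domain of the chart. Hence an arbitrary product of unitary groups is locally path-connected. If
  the translation action of \<open>G\<close> on it is principal, then \<open>G \<times> U\<close> is homeomorphic to an open subset
  of the product for some non-empty \<open>U\<close>, so \<open>G\<close> is locally path-connected. By compactness it then has
  finitely many path components, all of them open, and they coincide with its components.
\<close>

section \<open>Local path-connectedness\<close>

lemma locally_path_connected_space_local_contractions:
  assumes "\<And>x. x \<in> topspace X \<Longrightarrow>
      \<exists>W H. openin X W \<and> x \<in> W \<and>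
        continuous_map (prod_topology (subtopology X W) (top_of_set {0..1::real})) X H \<and>
        (\<forall>t\<in>{0..1}. H (x, t) = x) \<and> (\<forall>y\<in>W. H (y, 0) = x \<and> H (y, 1) = y)"
  shows "locally_path_connected_space X"
  unfolding locally_path_connected_space_im_kleinen
proof (intro allI impI, elim conjE)
  fix V x assume V: "openin X V" and x: "x \<in> V"
  then have xX: "x \<in> topspace X" using openin_subset by blast
  obtain W H where W: "openin X W" "x \<in> W"
    and H: "continuous_map (prod_topology (subtopology X W) (top_of_set {0..1::real})) X H"
    and Hx: "\<And>t. t \<in> {0..1} \<Longrightarrow> H (x, t) = x"
    and H01: "\<And>y. y \<in> W \<Longrightarrow> H (y, 0) = x" "\<And>y. y \<in> W \<Longrightarrow> H (y, 1) = y"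
    using assms[OF xX] by blast
  let ?W = "subtopology X W" and ?I = "top_of_set {0..1::real}"
  have tW: "topspace ?W = W" by (rule topspace_subtopology_subset[OF openin_subset[OF W(1)]])
  define B where "B = fst ` {p \<in> topspace (prod_topology ?W ?I). H p \<in> topspace X - V}"
  have "closedin (prod_topology ?W ?I) {p \<in> topspace (prod_topology ?W ?I). H p \<in> topspace X - V}"
    using H V by (intro closedin_continuous_map_preimage) auto
  then have "closedin ?W B"
    unfolding B_def using Abstract_Topological_Spaces.closed_map_fst[of ?I ?W]
    by (auto simp: closed_map_def compact_space_subtopology)
  then have "openin ?W (W - B)" using tW by (metis openin_diff openin_topspace)
  then have op: "openin X (W - B)" using W(1) openin_trans_full by blast
  have HV: "H (y, t) \<in> V" if "y \<in> W - B" "t \<in> {0..1}" for y t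
  proof -
    have "H (y, t) \<in> topspace X"
      using that tW continuous_map_funspace[OF H] by (auto simp: Pi_iff)
    then show ?thesis using that tW unfolding B_def by force
  qed
  have "x \<notin> B" using Hx x by (auto simp: B_def)
  moreover have "W - B \<subseteq> V" using HV[of _ 1] H01(2) by auto
  moreover have "\<exists>C. path_connectedin X C \<and> C \<subseteq> V \<and> x \<in> C \<and> y \<in> C" if y: "y \<in> W - B" for y
  proof (intro exI conjI)
    have "continuous_map ?I (prod_topology ?W ?I) (\<lambda>t. (y, t))"
      using y tW by (intro continuous_map_pairedI) auto
    then have "continuous_map ?I X (\<lambda>t. H (y, t))"
      using continuous_map_compose[OF _ H] by (auto simp: o_def)
    moreover have "path_connectedin ?I {0..1}"
      by (auto simp: path_connectedin_subtopology convex_imp_path_connected)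
    ultimately show "path_connectedin X ((\<lambda>t. H (y, t)) ` {0..1})"
      by (rule path_connectedin_continuous_map_image)
    show "(\<lambda>t. H (y, t)) ` {0..1} \<subseteq> V" using HV y by blast
    show "x \<in> (\<lambda>t. H (y, t)) ` {0..1}" using H01(1) y by (intro image_eqI[of _ _ 0]) auto
    show "y \<in> (\<lambda>t. H (y, t)) ` {0..1}" using H01(2) y by (intro image_eqI[of _ _ 1]) auto
  qed
  ultimately show "\<exists>U. openin X U \<and> x \<in> U \<and> U \<subseteq> V \<and>
      (\<forall>y\<in>U. \<exists>C. path_connectedin X C \<and> C \<subseteq> V \<and> x \<in> C \<and> y \<in> C)"
    using op W(2) by blast
qed

lemma finite_path_components_of_compact_space:
  assumes "compact_space X" "locally_path_connected_space X"
  shows "finite (path_components_of X)"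
proof -
  obtain \<F> where F: "finite \<F>" "\<F> \<subseteq> path_components_of X" "\<Union>\<F> = topspace X"
    using assms(1) openin_path_components_of_locally_path_connected_space[OF assms(2)]
      Union_path_components_of unfolding compact_space by metis
  have "C \<in> \<F>" if C: "C \<in> path_components_of X" for C
  proof -
    obtain x where x: "x \<in> C" using nonempty_path_components_of[OF C] by blast
    then obtain D where "D \<in> \<F>" "x \<in> D" using F(3) path_components_of_subset[OF C] by blast
    then show ?thesis using path_components_of_overlap[OF C] F(2) x by blast
  qed
  then have "path_components_of X \<subseteq> \<F>" by (rule subsetI)
  then show ?thesis using F(1) by (rule finite_subset)
qed

section \<open>The Cayley path between unitary matrices\<close>

lemma continuous_map_mult_algebra:
  fixes f g :: "'a \<Rightarrow> 'b::real_normed_algebra"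
  assumes "continuous_map X euclidean f" "continuous_map X euclidean g"
  shows "continuous_map X euclidean (\<lambda>x. f x * g x)"
  using assms by (simp add: continuous_map_atin tendsto_mult)

lemma continuous_map_prod_field:
  fixes f :: "'a \<Rightarrow> 'b \<Rightarrow> 'c::real_normed_field"
  assumes "\<And>i. i \<in> I \<Longrightarrow> continuous_map X euclidean (\<lambda>x. f x i)"
  shows "continuous_map X euclidean (\<lambda>x. \<Prod>i\<in>I. f x i)"
  using assms by (simp add: continuous_map_atin tendsto_prod)

lemma continuous_map_inverse_field:
  fixes f :: "'a \<Rightarrow> 'b::real_normed_field"
  assumes "continuous_map X euclidean f" "\<And>x. x \<in> topspace X \<Longrightarrow> f x \<noteq> 0"
  shows "continuous_map X euclidean (\<lambda>x. inverse (f x))"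
  using assms by (simp add: continuous_map_atin tendsto_inverse)

lemma continuous_map_of_real:
  assumes "continuous_map X euclideanreal f"
  shows "continuous_map X euclidean (\<lambda>x. of_real (f x) :: 'b::real_normed_algebra_1)"
  using assms by (simp add: continuous_map_atin tendsto_of_real)

lemma continuous_map_det:
  fixes M :: "'x \<Rightarrow> 'b::real_normed_field mat"
  assumes "\<And>x. x \<in> topspace X \<Longrightarrow> M x \<in> carrier_mat n n"
    and "\<And>i j. i < n \<Longrightarrow> j < n \<Longrightarrow> continuous_map X euclidean (\<lambda>x. M x $$ (i, j))"
  shows "continuous_map X euclidean (\<lambda>x. det (M x))"
proof (rule continuous_map_eq)
  show "continuous_map X euclidean
      (\<lambda>x. \<Sum>p | p permutes {0..<n}. signof p * (\<Prod>i = 0..<n. M x $$ (i, p i)))"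
  proof (intro continuous_map_sum continuous_map_mult_algebra continuous_map_prod_field)
    fix p i assume "p \<in> {p. p permutes {0..<n}}" "i \<in> {0..<n}"
    then have "p i < n" "i < n" using permutes_in_image[of p "{0..<n}" i] by auto
    then show "continuous_map X euclidean (\<lambda>x. M x $$ (i, p i))" using assms(2) by blast
  qed (auto simp: finite_permutations)
qed (rule det_def'[OF assms(1), symmetric])

lemma continuous_map_adj_mat_entry:
  fixes M :: "'x \<Rightarrow> 'b::real_normed_field mat"
  assumes M: "\<And>x. x \<in> topspace X \<Longrightarrow> M x \<in> carrier_mat n n"
    and ent: "\<And>i j. i < n \<Longrightarrow> j < n \<Longrightarrow> continuous_map X euclidean (\<lambda>x. M x $$ (i, j))"
    and ij: "i < n" "j < n"
  shows "continuous_map X euclidean (\<lambda>x. adj_mat (M x) $$ (i, j))"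
proof (rule continuous_map_eq)
  obtain m where n: "n = Suc m" using ij by (cases n) auto
  have "continuous_map X euclidean (\<lambda>x. det (mat_delete (M x) j i))"
  proof (rule continuous_map_det)
    fix x assume "x \<in> topspace X"
    then show "mat_delete (M x) j i \<in> carrier_mat m m"
      using mat_delete_carrier[OF M] n by force
  next
    fix k l assume kl: "k < m" "l < m"
    show "continuous_map X euclidean (\<lambda>x. mat_delete (M x) j i $$ (k, l))"
    proof (rule continuous_map_eq)
      show "continuous_map X euclidean (\<lambda>x. M x $$ (insert_index j k, insert_index i l))"
        using kl by (intro ent) (auto simp: insert_index_def n)
      fix x assume x: "x \<in> topspace X"
      show "M x $$ (insert_index j k, insert_index i l) = mat_delete (M x) j i $$ (k, l)"
        using mat_delete_index[OF M[OF x, unfolded n]] ij kl n by simp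
    qed
  qed
  then show "continuous_map X euclidean (\<lambda>x. (-1) ^ (j + i) * det (mat_delete (M x) j i))"
    by (intro continuous_map_mult_algebra) auto
  fix x assume "x \<in> topspace X"
  then show "(-1) ^ (j + i) * det (mat_delete (M x) j i) = adj_mat (M x) $$ (i, j)"
    using M ij by (fastforce simp: adj_mat_def cofactor_def)
qed

lemma unitary_eigenvalue_norm:
  assumes A: "A \<in> carrier (unitary_group n)"
    and v: "v \<in> carrier_vec n" "v \<noteq> 0\<^sub>v n" and ev: "A *\<^sub>v v = k \<cdot>\<^sub>v v"
  shows "cmod k = 1"
proof -
  have Ac: "A \<in> carrier_mat n n" "mat_adjoint A * A = 1\<^sub>m n" using A by (auto simp: unitary_group_def)
  define V where "V = mat n 1 (\<lambda>(i, j). v $ i)"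
  have V: "V \<in> carrier_mat n 1" by (simp add: V_def)
  have colV: "col V 0 = v" using v by (auto simp: V_def)
  have AV: "A * V = k \<cdot>\<^sub>m V"
  proof (rule eq_matI)
    fix i j assume "i < dim_row (k \<cdot>\<^sub>m V)" "j < dim_col (k \<cdot>\<^sub>m V)"
    then have ij: "i < n" "j = 0" using V by auto
    have "(A * V) $$ (i, j) = (A *\<^sub>v v) $ i" using ij Ac V colV by simp
    then show "(A * V) $$ (i, j) = (k \<cdot>\<^sub>m V) $$ (i, j)" using ij v V by (simp add: ev V_def)
  qed (use Ac V in auto)
  have aV: "mat_adjoint (k \<cdot>\<^sub>m V) = cnj k \<cdot>\<^sub>m mat_adjoint V"
    by (rule eq_matI) (auto simp: index_mat_adjoint V_def)
  have "mat_adjoint V * V = mat_adjoint V * (mat_adjoint A * A * V)" using Ac V by simp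
  also have "\<dots> = mat_adjoint (A * V) * (A * V)"
    unfolding mat_adjoint_mult[OF Ac(1) V] using Ac(1) V
    by (simp add: assoc_mult_mat[of _ 1 n _ n _ 1] assoc_mult_mat[of _ n n _ n _ 1])
  also have "\<dots> = (cnj k * k) \<cdot>\<^sub>m (mat_adjoint V * V)"
    unfolding AV aV using V by (auto simp: mult_smult_distrib[of _ 1 n] mult_smult_assoc_mat[of _ 1 n _ 1])
  finally have eq: "mat_adjoint V * V = (cnj k * k) \<cdot>\<^sub>m (mat_adjoint V * V)" .
  have "((cnj k * k) \<cdot>\<^sub>m (mat_adjoint V * V)) $$ (0, 0) = cnj k * k * (mat_adjoint V * V) $$ (0, 0)"
    using V by (intro index_smult_mat(1)) auto
  from trans[OF arg_cong[OF eq, of "\<lambda>M. M $$ (0, 0)"] this]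
  have "(mat_adjoint V * V) $$ (0, 0) = cnj k * k * (mat_adjoint V * V) $$ (0, 0)" .
  moreover have "(mat_adjoint V * V) $$ (0, 0) \<noteq> 0"
  proof -
    have "(mat_adjoint V * V) $$ (0, 0) = (\<Sum>i = 0..<n. cnj (v $ i) * v $ i)"
      by (simp add: scalar_prod_def index_mat_adjoint V_def)
    also have "\<dots> = v \<bullet>c v" using v by (simp add: scalar_prod_def mult.commute)
    finally show ?thesis using v by simp
  qed
  ultimately have "cnj k * k = 1" by simp
  then have "of_real ((cmod k)\<^sup>2) = (1::complex)" by (simp only: complex_norm_square mult.commute)
  then show ?thesis by (simp add: power2_eq_1_iff del: of_real_power) (smt (verit) norm_ge_zero)
qed

definition affine_mat :: "real \<Rightarrow> real \<Rightarrow> complex mat \<Rightarrow> complex mat" where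
  "affine_mat a b A = of_real a \<cdot>\<^sub>m A + of_real b \<cdot>\<^sub>m 1\<^sub>m (dim_row A)"

lemma affine_mat_carrier: "A \<in> carrier_mat n n \<Longrightarrow> affine_mat a b A \<in> carrier_mat n n"
  by (auto simp: affine_mat_def)

lemma adjoint_affine_mat_mult:
  assumes A: "A \<in> carrier (unitary_group n)"
  shows "mat_adjoint (affine_mat a b A) * affine_mat a b A =
    of_real (a\<^sup>2 + b\<^sup>2) \<cdot>\<^sub>m 1\<^sub>m n + of_real (a * b) \<cdot>\<^sub>m (A + mat_adjoint A)"
proof -
  let ?a = "complex_of_real a" and ?b = "complex_of_real b"
  have A: "A \<in> carrier_mat n n" "mat_adjoint A \<in> carrier_mat n n" "mat_adjoint A * A = 1\<^sub>m n"
    using A by (auto simp: unitary_group_def)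
  have adj: "mat_adjoint (affine_mat a b A) = ?a \<cdot>\<^sub>m mat_adjoint A + ?b \<cdot>\<^sub>m 1\<^sub>m n"
    using A by (intro eq_matI) (auto simp: affine_mat_def index_mat_adjoint)
  have "mat_adjoint (affine_mat a b A) * affine_mat a b A =
      (?a \<cdot>\<^sub>m mat_adjoint A) * (?a \<cdot>\<^sub>m A + ?b \<cdot>\<^sub>m 1\<^sub>m n) + (?b \<cdot>\<^sub>m 1\<^sub>m n) * (?a \<cdot>\<^sub>m A + ?b \<cdot>\<^sub>m 1\<^sub>m n)"
    unfolding adj using A by (simp add: affine_mat_def) (intro add_mult_distrib_mat[of _ n n _ _ n], auto)
  also have "\<dots> = ?a \<cdot>\<^sub>m (?a \<cdot>\<^sub>m 1\<^sub>m n) + ?b \<cdot>\<^sub>m (?a \<cdot>\<^sub>m mat_adjoint A) +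
      (?a \<cdot>\<^sub>m (?b \<cdot>\<^sub>m A) + ?b \<cdot>\<^sub>m (?b \<cdot>\<^sub>m 1\<^sub>m n))"
    using A by (simp add: mult_smult_assoc_mat[of _ n n _ n] mult_add_distrib_mat[of _ n n _ n]
        mult_smult_distrib[of _ n n _ n])
  also have "\<dots> = of_real (a\<^sup>2 + b\<^sup>2) \<cdot>\<^sub>m 1\<^sub>m n + of_real (a * b) \<cdot>\<^sub>m (A + mat_adjoint A)"
    using A by (intro eq_matI) (auto simp: algebra_simps power2_eq_square)
  finally show ?thesis .
qed

lemma affine_mat_mult_vec:
  assumes "A \<in> carrier_mat n n" "v \<in> carrier_vec n"
  shows "affine_mat a b A *\<^sub>v v = of_real a \<cdot>\<^sub>v (A *\<^sub>v v) + of_real b \<cdot>\<^sub>v v"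
proof -
  have "(k \<cdot>\<^sub>m B) *\<^sub>v v = k \<cdot>\<^sub>v (B *\<^sub>v v)" if "B \<in> carrier_mat n n" for k and B :: "complex mat"
    using that assms(2) by (intro eq_vecI) (auto simp: scalar_prod_def sum_distrib_left mult.assoc)
  then show ?thesis
    using assms by (simp add: affine_mat_def add_mult_distrib_mat_vec[of _ n n])
qed

lemma det_affine_mat_nonzero:
  assumes A: "A \<in> carrier (unitary_group n)" and ab: "\<bar>a\<bar> < \<bar>b\<bar>"
  shows "det (affine_mat a b A) \<noteq> 0"
proof
  assume d: "det (affine_mat a b A) = 0"
  have Ac: "A \<in> carrier_mat n n" using A by (auto simp: unitary_group_def)
  obtain v where v: "v \<in> carrier_vec n" "v \<noteq> 0\<^sub>v n" "affine_mat a b A *\<^sub>v v = 0\<^sub>v n"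
    using d det_0_iff_vec_prod_zero[OF affine_mat_carrier[OF Ac]] by blast
  have eq: "of_real a * (A *\<^sub>v v) $ i + of_real b * v $ i = 0" if i: "i < n" for i
  proof -
    have "(of_real a \<cdot>\<^sub>v (A *\<^sub>v v) + of_real b \<cdot>\<^sub>v v) $ i = 0"
      using i by (simp only: affine_mat_mult_vec[OF Ac v(1), of a b, unfolded v(3), symmetric] index_zero_vec)
    then show ?thesis using i v(1) Ac by simp
  qed
  show False
  proof (cases "a = 0")
    case True
    then have "v = 0\<^sub>v n" using eq ab v(1) by (intro eq_vecI) auto
    then show False using v(2) by simp
  next
    case False
    have "A *\<^sub>v v = (- (of_real b / of_real a)) \<cdot>\<^sub>v v"
    proof (rule eq_vecI)
      fix i assume "i < dim_vec ((- (of_real b / of_real a)) \<cdot>\<^sub>v v)"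
      then have i: "i < n" using v by simp
      have "of_real a * (A *\<^sub>v v) $ i = - (of_real b * v $ i)" using eq[OF i] by (simp add: eq_neg_iff_add_eq_0)
      then show "(A *\<^sub>v v) $ i = ((- (of_real b / of_real a)) \<cdot>\<^sub>v v) $ i"
        using i v(1) False by (simp add: field_simps)
    qed (use Ac v in auto)
    from unitary_eigenvalue_norm[OF A v(1,2) this] have "\<bar>b\<bar> = \<bar>a\<bar>"
      using False by (simp add: norm_divide)
    then show False using ab by simp
  qed
qed

text \<open>
  With \<open>K = (A - 1) (A + 1)\<^sup>-\<^sup>1\<close>, the (skew-Hermitian) Cayley transform of \<open>A\<close>, this is
  \<open>(1 + t K) (1 - t K)\<^sup>-\<^sup>1\<close>, with the factors \<open>(A + 1)\<^sup>-\<^sup>1\<close> cancelled; the adjugate divided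
  by the determinant is the inverse, which makes continuity in \<open>A\<close> and \<open>t\<close> visible. The value
  is meaningless if \<open>t = 0\<close> and \<open>-1\<close> is an eigenvalue of \<open>A\<close>.
\<close>
definition cayley_path :: "complex mat \<Rightarrow> real \<Rightarrow> complex mat" where
  "cayley_path A t =
     affine_mat (1 + t) (1 - t) A *
     (inverse (det (affine_mat (1 - t) (1 + t) A)) \<cdot>\<^sub>m adj_mat (affine_mat (1 - t) (1 + t) A))"

lemma det_cayley_denominator:
  assumes A: "A \<in> carrier (unitary_group n)" and "det (affine_mat 1 1 A) \<noteq> 0" and "t \<in> {0..1}"
  shows "det (affine_mat (1 - t) (1 + t) A) \<noteq> 0"
  using det_affine_mat_nonzero[OF A, of "1 - t" "1 + t"] assms by (cases "t = 0") auto

lemma mult_inverse_det_smult_adj_mat: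
  fixes D :: "'b::field mat"
  assumes "D \<in> carrier_mat n n" "det D \<noteq> 0"
  shows "D * (inverse (det D) \<cdot>\<^sub>m adj_mat D) = 1\<^sub>m n"
  using adj_mat[OF assms(1)] assms
  by (simp add: mult_smult_distrib[of _ n n _ n]) (auto intro!: eq_matI)

lemma cayley_path_unitary:
  assumes A: "A \<in> carrier (unitary_group n)" and "det (affine_mat 1 1 A) \<noteq> 0" and "t \<in> {0..1}"
  shows "cayley_path A t \<in> carrier (unitary_group n)"
proof -
  have Ac: "A \<in> carrier_mat n n" using A by (auto simp: unitary_group_def)
  define N where "N = affine_mat (1 + t) (1 - t) A"
  define D where "D = affine_mat (1 - t) (1 + t) A"
  define E where "E = inverse (det D) \<cdot>\<^sub>m adj_mat D"
  have N: "N \<in> carrier_mat n n" and D: "D \<in> carrier_mat n n"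
    using Ac by (simp_all add: N_def D_def affine_mat_carrier)
  then have E: "E \<in> carrier_mat n n" using adj_mat(1)[OF D] by (simp add: E_def)
  have DE: "D * E = 1\<^sub>m n" unfolding E_def
    using mult_inverse_det_smult_adj_mat[OF D] det_cayley_denominator[OF assms] by (simp add: D_def)
  have X: "cayley_path A t = N * E" by (simp add: cayley_path_def N_def D_def E_def)
  have NE: "N * E \<in> carrier_mat n n" using N E by simp
  note aj = mat_adjoint_carrier[OF N] mat_adjoint_carrier[OF D] mat_adjoint_carrier[OF E]
  have ND: "mat_adjoint N * N = mat_adjoint D * D"
    unfolding N_def D_def adjoint_affine_mat_mult[OF A] by (simp add: algebra_simps)
  have "mat_adjoint (N * E) * (N * E) = mat_adjoint E * (mat_adjoint N * N * E)"
    using N E aj by (simp add: mat_adjoint_mult[OF N E] assoc_mult_mat[of _ n n _ n _ n])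
  also have "\<dots> = mat_adjoint (D * E) * (D * E)"
    using D E aj by (simp add: ND mat_adjoint_mult[OF D E] assoc_mult_mat[of _ n n _ n _ n])
  also have "\<dots> = 1\<^sub>m n"
    unfolding DE by (intro eq_matI) (auto simp: scalar_prod_def index_mat_adjoint if_distrib cong: if_cong)
  finally have "mat_adjoint (N * E) * (N * E) = 1\<^sub>m n" .
  moreover from mat_mult_left_right_inverse[OF mat_adjoint_carrier[OF NE] NE this]
  have "N * E * mat_adjoint (N * E) = 1\<^sub>m n" .
  ultimately show ?thesis using NE by (simp add: X unitary_group_def)
qed

lemma affine_mat_0_left: "A \<in> carrier_mat n n \<Longrightarrow> affine_mat 0 b A = of_real b \<cdot>\<^sub>m 1\<^sub>m n"
  and affine_mat_0_right: "A \<in> carrier_mat n n \<Longrightarrow> affine_mat a 0 A = of_real a \<cdot>\<^sub>m A"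
  and affine_mat_one: "affine_mat a b (1\<^sub>m n) = of_real (a + b) \<cdot>\<^sub>m 1\<^sub>m n"
  by (auto simp: affine_mat_def intro!: eq_matI)

lemma cayley_path_0:
  assumes "A \<in> carrier_mat n n" "det (affine_mat 1 1 A) \<noteq> 0"
  shows "cayley_path A 0 = 1\<^sub>m n"
  using mult_inverse_det_smult_adj_mat[OF affine_mat_carrier[OF assms(1)] assms(2)]
  by (simp add: cayley_path_def)

lemma cayley_path_1:
  assumes "A \<in> carrier_mat n n"
  shows "cayley_path A 1 = A"
proof -
  define D :: "complex mat" where "D = 2 \<cdot>\<^sub>m 1\<^sub>m n"
  have D: "D \<in> carrier_mat n n" "det D \<noteq> 0" by (simp_all add: D_def)
  have aD: "affine_mat (1 - 1) (1 + 1) A = D" "affine_mat (1 + 1) (1 - 1) A = A * D"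
    using assms by (simp_all add: D_def affine_mat_0_left affine_mat_0_right mult_smult_distrib[of _ n n _ n])
  have "cayley_path A 1 = A * (D * (inverse (det D) \<cdot>\<^sub>m adj_mat D))"
    unfolding cayley_path_def aD using D assms adj_mat(1)[OF D(1)]
    by (simp add: assoc_mult_mat[of _ n n _ n _ n])
  then show ?thesis using assms by (simp add: mult_inverse_det_smult_adj_mat[OF D])
qed

lemma cayley_path_one:
  "cayley_path (1\<^sub>m n) t = 1\<^sub>m n"
  unfolding cayley_path_def affine_mat_one
  using mult_inverse_det_smult_adj_mat[of "2 \<cdot>\<^sub>m 1\<^sub>m n :: complex mat" n] by simp

lemma continuous_map_affine_mat_entry:
  assumes A: "continuous_map X (unitary_topology n) A"
    and ab: "continuous_map X euclideanreal a" "continuous_map X euclideanreal b"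
    and ij: "i < n" "j < n"
  shows "continuous_map X euclidean (\<lambda>x. affine_mat (a x) (b x) (A x) $$ (i, j))"
proof (rule continuous_map_eq)
  show "continuous_map X euclidean
      (\<lambda>x. of_real (a x) * A x $$ (i, j) + of_real (b x) * (if i = j then 1 else 0))"
    using continuous_map_compose[OF A continuous_map_unitary_entry[OF ij]] ab
    by (intro continuous_map_add continuous_map_mult_algebra continuous_map_of_real) (auto simp: o_def)
  fix x assume "x \<in> topspace X"
  then have "A x \<in> carrier (unitary_group n)"
    using continuous_map_funspace[OF A] by (auto simp: topspace_unitary_topology)
  then show "of_real (a x) * A x $$ (i, j) + of_real (b x) * (if i = j then 1 else 0) =
      affine_mat (a x) (b x) (A x) $$ (i, j)"
    using ij by (auto simp: affine_mat_def unitary_group_def)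
qed

lemma continuous_map_cayley_path:
  assumes A: "continuous_map X (unitary_topology n) A" and t: "continuous_map X euclideanreal t"
    and det: "\<And>x. x \<in> topspace X \<Longrightarrow> det (affine_mat 1 1 (A x)) \<noteq> 0"
    and t01: "\<And>x. x \<in> topspace X \<Longrightarrow> t x \<in> {0..1}"
  shows "continuous_map X (unitary_topology n) (\<lambda>x. cayley_path (A x) (t x))"
proof -
  have Au: "A x \<in> carrier (unitary_group n)" if "x \<in> topspace X" for x
    using that continuous_map_funspace[OF A] by (auto simp: topspace_unitary_topology)
  then have Ac: "A x \<in> carrier_mat n n" if "x \<in> topspace X" for x
    using that by (auto simp: unitary_group_def)
  let ?N = "\<lambda>x. affine_mat (1 + t x) (1 - t x) (A x)"
  let ?D = "\<lambda>x. affine_mat (1 - t x) (1 + t x) (A x)"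
  have N: "?N x \<in> carrier_mat n n" and D: "?D x \<in> carrier_mat n n" if "x \<in> topspace X" for x
    using Ac[OF that] by (auto intro: affine_mat_carrier)
  have t': "continuous_map X euclideanreal (\<lambda>x. 1 + t x)" "continuous_map X euclideanreal (\<lambda>x. 1 - t x)"
    using t by (auto intro!: continuous_map_add continuous_map_diff)
  note Dent = continuous_map_affine_mat_entry[OF A t'(2,1)]
  show ?thesis
  proof (rule continuous_map_into_unitary)
    show "(\<lambda>x. cayley_path (A x) (t x)) \<in> topspace X \<rightarrow> carrier (unitary_group n)"
      using cayley_path_unitary Au det t01 by auto
    fix i j assume ij: "i < n" "j < n"
    show "continuous_map X euclidean (\<lambda>x. cayley_path (A x) (t x) $$ (i, j))"
    proof (rule continuous_map_eq)
      show "continuous_map X euclidean (\<lambda>x. \<Sum>k = 0..<n. ?N x $$ (i, k) *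
          (inverse (det (?D x)) * adj_mat (?D x) $$ (k, j)))"
        using ij det_cayley_denominator[OF Au det t01] D
        by (intro continuous_map_sum continuous_map_mult_algebra continuous_map_inverse_field
            continuous_map_det[of _ _ n] continuous_map_adj_mat_entry[of _ _ n] Dent
            continuous_map_affine_mat_entry[OF A t']) auto
      fix x assume x: "x \<in> topspace X"
      show "(\<Sum>k = 0..<n. ?N x $$ (i, k) * (inverse (det (?D x)) * adj_mat (?D x) $$ (k, j))) =
          cayley_path (A x) (t x) $$ (i, j)"
        using ij N[OF x] D[OF x] adj_mat(1)[OF D[OF x]] by (simp add: cayley_path_def scalar_prod_def)
    qed
  qed
qed

section \<open>Connectedness of the unitary groups\<close>

lemma continuous_map_unitary_left_mult:
  assumes "A \<in> carrier (unitary_group n)"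
  shows "continuous_map (unitary_topology n) (unitary_topology n) (\<lambda>B. A * B)"
  using continuous_map_compose[OF continuous_map_pairedI continuous_map_unitary_mult,
      of "unitary_topology n" n "\<lambda>_. A" "\<lambda>B. B"] assms
  by (simp add: o_def topspace_unitary_topology)

lemma openin_unitary_cayley_domain:
  "openin (unitary_topology n) {A \<in> topspace (unitary_topology n). det (affine_mat 1 1 A) \<noteq> 0}"
proof -
  have "continuous_map (unitary_topology n) euclidean (\<lambda>A. det (affine_mat 1 1 A))"
    using continuous_map_affine_mat_entry[of "unitary_topology n" n "\<lambda>A. A" "\<lambda>_. 1" "\<lambda>_. 1"]
    by (intro continuous_map_det[of _ _ n])
      (auto simp: topspace_unitary_topology unitary_group_def affine_mat_carrier)
  from openin_continuous_map_preimage[OF this, of "- {0}"] show ?thesis by (simp add: open_Compl)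
qed

lemma locally_path_connected_space_unitary: "locally_path_connected_space (unitary_topology n)"
proof (rule locally_path_connected_space_local_contractions)
  let ?U = "unitary_topology n"
  fix A assume "A \<in> topspace ?U"
  then have A: "A \<in> carrier (unitary_group n)" by (simp add: topspace_unitary_topology)
  then have Ac: "A \<in> carrier_mat n n" "A * mat_adjoint A = 1\<^sub>m n" "mat_adjoint A * A = 1\<^sub>m n"
    by (auto simp: unitary_group_def)
  have A': "mat_adjoint A \<in> carrier (unitary_group n)"
    using Ac by (simp add: unitary_group_def mat_adjoint_adjoint)
  let ?D = "{B \<in> topspace ?U. det (affine_mat 1 1 B) \<noteq> 0}"
  define W where "W = {B \<in> topspace ?U. mat_adjoint A * B \<in> ?D}"
  let ?H = "\<lambda>p. A * cayley_path (mat_adjoint A * fst p) (snd p)"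
  let ?P = "prod_topology (subtopology ?U W) (top_of_set {0..1::real})"
  have "openin ?U W"
    unfolding W_def
    using openin_continuous_map_preimage[OF continuous_map_unitary_left_mult[OF A'] openin_unitary_cayley_domain] .
  moreover have "A \<in> W"
    using A Ac by (simp add: W_def topspace_unitary_topology affine_mat_one unitary_group_def)
      (auto intro!: eq_matI simp: scalar_prod_def index_mat_adjoint if_distrib cong: if_cong)
  moreover have "continuous_map ?P ?U ?H"
  proof -
    have "continuous_map ?P (subtopology ?U W) fst" "continuous_map ?P (top_of_set {0..1}) snd"
      by (auto intro: continuous_map_fst continuous_map_snd)
    then have fs: "continuous_map ?P ?U fst" "continuous_map ?P euclideanreal snd"
      by (auto simp: continuous_map_in_subtopology)
    have "continuous_map ?P ?U (\<lambda>p. cayley_path (mat_adjoint A * fst p) (snd p))"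
      using continuous_map_compose[OF fs(1) continuous_map_unitary_left_mult[OF A']] fs(2)
      by (intro continuous_map_cayley_path) (auto simp: W_def o_def)
    from continuous_map_compose[OF this continuous_map_unitary_left_mult[OF A]] show ?thesis
      by (simp add: o_def)
  qed
  moreover have "\<forall>t\<in>{0..1}. ?H (A, t) = A"
    using Ac cayley_path_one by simp
  moreover have "\<forall>B\<in>W. ?H (B, 0) = A \<and> ?H (B, 1) = B"
  proof
    fix B assume B: "B \<in> W"
    then have Bc: "B \<in> carrier_mat n n" "det (affine_mat 1 1 (mat_adjoint A * B)) \<noteq> 0"
      by (auto simp: W_def topspace_unitary_topology unitary_group_def)
    have AB: "mat_adjoint A * B \<in> carrier_mat n n"
      using mult_carrier_mat[OF mat_adjoint_carrier[OF Ac(1)] Bc(1)] .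
    have "A * (mat_adjoint A * B) = A * mat_adjoint A * B"
      using Ac(1) Bc(1) by (simp add: assoc_mult_mat[of _ n n _ n _ n])
    then show "?H (B, 0) = A \<and> ?H (B, 1) = B"
      using Ac Bc by (simp add: cayley_path_0[OF AB] cayley_path_1[OF AB])
  qed
  ultimately show "\<exists>W H. openin ?U W \<and> A \<in> W \<and>
      continuous_map (prod_topology (subtopology ?U W) (top_of_set {0..1::real})) ?U H \<and>
      (\<forall>t\<in>{0..1}. H (A, t) = A) \<and> (\<forall>B\<in>W. H (B, 0) = A \<and> H (B, 1) = B)"
    by blast
qed

lemma smult_unitary:
  assumes "A \<in> carrier (unitary_group n)" "cmod c = 1"
  shows "c \<cdot>\<^sub>m A \<in> carrier (unitary_group n)"
proof -
  have A: "A \<in> carrier_mat n n" "A * mat_adjoint A = 1\<^sub>m n" "mat_adjoint A * A = 1\<^sub>m n"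
    using assms by (auto simp: unitary_group_def)
  have "mat_adjoint (c \<cdot>\<^sub>m A) = cnj c \<cdot>\<^sub>m mat_adjoint A"
    by (rule eq_matI) (auto simp: index_mat_adjoint)
  moreover have cc: "c * cnj c = 1" using assms(2) by (simp flip: complex_norm_square)
  moreover have "cnj c * c = 1" using cc by (simp only: mult.commute)
  ultimately show ?thesis
    using A by (simp add: unitary_group_def mult_smult_distrib[of _ n n _ n] mult_smult_assoc_mat[of _ n n _ n]
        smult_smult_assoc) (auto intro!: eq_matI)
qed

lemma unitary_rotation_into_cayley_domain:
  assumes A: "A \<in> carrier (unitary_group n)"
  obtains s where "det (affine_mat 1 1 (cis s \<cdot>\<^sub>m A)) \<noteq> 0"
proof -
  have Ac: "A \<in> carrier_mat n n" using A by (auto simp: unitary_group_def)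
  have inf: "infinite (range cis)"
  proof -
    have "inj_on cis {- pi<..pi}" by (rule inj_on_inverseI[of _ Arg]) (simp add: Arg_cis)
    moreover have "infinite {- pi<..pi}" by simp
    ultimately show ?thesis by (meson finite_imageD finite_subset image_mono subset_UNIV)
  qed
  have fin: "finite ((\<lambda>k. - inverse k) ` spectrum A)"
    using card_finite_spectrum(1)[OF Ac] by simp
  have "\<not> range cis \<subseteq> (\<lambda>k. - inverse k) ` spectrum A"
    using inf finite_subset[OF _ fin] by (rule contrapos_nn)
  then obtain s where s: "cis s \<notin> (\<lambda>k. - inverse k) ` spectrum A"
    by blast
  have "det (affine_mat 1 1 (cis s \<cdot>\<^sub>m A)) \<noteq> 0"
  proof
    assume d: "det (affine_mat 1 1 (cis s \<cdot>\<^sub>m A)) = 0"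
    have M: "affine_mat 1 1 (cis s \<cdot>\<^sub>m A) \<in> carrier_mat n n" using Ac by (simp add: affine_mat_carrier)
    obtain v where v: "v \<in> carrier_vec n" "v \<noteq> 0\<^sub>v n" "affine_mat 1 1 (cis s \<cdot>\<^sub>m A) *\<^sub>v v = 0\<^sub>v n"
      using d det_0_iff_vec_prod_zero[OF M] by blast
    have "affine_mat 1 1 (cis s \<cdot>\<^sub>m A) *\<^sub>v v = (cis s \<cdot>\<^sub>m A) *\<^sub>v v + v"
      using affine_mat_mult_vec[of "cis s \<cdot>\<^sub>m A" n v 1 1] Ac v(1) by simp
    also have "(cis s \<cdot>\<^sub>m A) *\<^sub>v v = cis s \<cdot>\<^sub>v (A *\<^sub>v v)"
      using Ac v(1) by (intro eq_vecI) (auto simp: scalar_prod_def sum_distrib_left mult.assoc)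
    finally have mv: "affine_mat 1 1 (cis s \<cdot>\<^sub>m A) *\<^sub>v v = cis s \<cdot>\<^sub>v (A *\<^sub>v v) + v" .
    have eq: "cis s * (A *\<^sub>v v) $ i + v $ i = 0" if i: "i < n" for i
    proof -
      have "(cis s \<cdot>\<^sub>v (A *\<^sub>v v) + v) $ i = 0"
        using i by (simp only: mv[unfolded v(3), symmetric] index_zero_vec)
      then show ?thesis using i v(1) Ac by simp
    qed
    have "A *\<^sub>v v = (- inverse (cis s)) \<cdot>\<^sub>v v"
    proof (rule eq_vecI)
      fix i assume "i < dim_vec ((- inverse (cis s)) \<cdot>\<^sub>v v)"
      then have i: "i < n" using v by simp
      have "v $ i = - (cis s * (A *\<^sub>v v) $ i)" using eq[OF i] by (simp add: eq_neg_iff_add_eq_0 add.commute)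
      then show "(A *\<^sub>v v) $ i = ((- inverse (cis s)) \<cdot>\<^sub>v v) $ i"
        using i v(1) by (simp add: field_simps)
    qed (use Ac v in auto)
    then have "- inverse (cis s) \<in> spectrum A"
      using v Ac by (auto simp: spectrum_def eigenvalue_def eigenvector_def)
    then have "cis s \<in> (\<lambda>k. - inverse k) ` spectrum A" by (rule rev_image_eqI) simp
    then show False using s by simp
  qed
  then show thesis by (rule that)
qed

lemma path_component_of_unitary_one:
  assumes A: "A \<in> carrier (unitary_group n)"
  shows "path_component_of (unitary_topology n) (1\<^sub>m n) A"
proof -
  let ?U = "unitary_topology n" and ?I = "top_of_set {0..1::real}"
  have Ac: "A \<in> carrier_mat n n" using A by (auto simp: unitary_group_def)
  obtain s where s: "det (affine_mat 1 1 (cis s \<cdot>\<^sub>m A)) \<noteq> 0"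
    using unitary_rotation_into_cayley_domain[OF A] by blast
  have B: "cis s \<cdot>\<^sub>m A \<in> carrier (unitary_group n)" using smult_unitary[OF A] by simp
  then have Bc: "cis s \<cdot>\<^sub>m A \<in> carrier_mat n n" by (auto simp: unitary_group_def)
  have "continuous_map ?I ?U (\<lambda>t. cayley_path (cis s \<cdot>\<^sub>m A) t)"
    using s B by (intro continuous_map_cayley_path) (auto simp: topspace_unitary_topology)
  then have "path_component_of ?U (1\<^sub>m n) (cis s \<cdot>\<^sub>m A)"
    unfolding path_component_of_def pathin_def
    using cayley_path_0[OF Bc s] cayley_path_1[OF Bc] by blast
  moreover have "path_component_of ?U A (cis s \<cdot>\<^sub>m A)"
  proof -
    have "continuous_map ?I ?U (\<lambda>t. cis (t * s) \<cdot>\<^sub>m A)"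
    proof (rule continuous_map_into_unitary)
      fix i j assume "i < n" "j < n"
      then show "continuous_map ?I euclidean (\<lambda>t. (cis (t * s) \<cdot>\<^sub>m A) $$ (i, j))"
        using Ac by (auto intro!: continuous_intros)
    qed (use smult_unitary[OF A] in auto)
    moreover have "cis (0 * s) \<cdot>\<^sub>m A = A" "cis (1 * s) \<cdot>\<^sub>m A = cis s \<cdot>\<^sub>m A"
      by (auto intro!: eq_matI)
    ultimately show ?thesis unfolding path_component_of_def pathin_def by blast
  qed
  ultimately show ?thesis by (blast intro: path_component_of_sym path_component_of_trans)
qed

lemma path_connected_space_unitary: "path_connected_space (unitary_topology n)"
  unfolding path_connected_space_iff_path_component topspace_unitary_topology
  by (blast intro: path_component_of_trans path_component_of_sym path_component_of_unitary_one)

lemma locally_path_connected_space_unitary_product: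
  "locally_path_connected_space (unitary_product_topology G R)"
  by (simp add: unitary_product_topology_def locally_path_connected_space_product_topology
      path_connected_space_unitary locally_path_connected_space_unitary)

lemma topspace_unitary_product_nonempty: "topspace (unitary_product_topology G R) \<noteq> {}"
proof -
  have "carrier (unitary_group n) \<noteq> {}" for n
    using monoid.one_closed[OF group.is_monoid[OF group_unitary_group[of n]]] by auto
  then show ?thesis
    by (simp add: unitary_product_topology_def topspace_unitary_topology PiE_eq_empty_iff)
qed

section \<open>Principal actions of compact groups\<close>

lemma path_component_set_rcoset:
  assumes G: "topological_group G T" and a: "a \<in> carrier G"
  shows "path_component_of_set T \<one>\<^bsub>G\<^esub> #>\<^bsub>G\<^esub> a = path_component_of_set T a"
proof -
  interpret group G using G by (simp add: topological_group_def)
  have ts: "topspace T = carrier G"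
    and cm: "continuous_map (prod_topology T T) T (\<lambda>(x, y). x \<otimes>\<^bsub>G\<^esub> y)"
    using G by (auto simp: topological_group_def)
  have trans: "path_component_of T (x \<otimes>\<^bsub>G\<^esub> b) (y \<otimes>\<^bsub>G\<^esub> b)"
    if "path_component_of T x y" "b \<in> carrier G" for x y b
  proof (rule path_component_of_continuous_image[OF _ that(1)])
    show "continuous_map T T (\<lambda>x. x \<otimes>\<^bsub>G\<^esub> b)"
      using continuous_map_compose[OF continuous_map_pairedI cm, of T "\<lambda>x. x" "\<lambda>x. b"] that ts
      by (simp add: o_def)
  qed
  show ?thesis
  proof (intro equalityI subsetI)
    fix z assume "z \<in> path_component_of_set T \<one>\<^bsub>G\<^esub> #>\<^bsub>G\<^esub> a"
    then show "z \<in> path_component_of_set T a" using trans[OF _ a] a by (force simp: r_coset_def)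
  next
    fix z assume "z \<in> path_component_of_set T a"
    then have z: "path_component_of T a z" "z \<in> carrier G"
      using ts path_component_in_topspace by fastforce+
    then have "path_component_of T \<one>\<^bsub>G\<^esub> (z \<otimes>\<^bsub>G\<^esub> inv\<^bsub>G\<^esub> a)" using trans[OF z(1), of "inv\<^bsub>G\<^esub> a"] a by simp
    moreover have "z = z \<otimes>\<^bsub>G\<^esub> inv\<^bsub>G\<^esub> a \<otimes>\<^bsub>G\<^esub> a" using a z by (simp add: m_assoc)
    ultimately show "z \<in> path_component_of_set T \<one>\<^bsub>G\<^esub> #>\<^bsub>G\<^esub> a" unfolding r_coset_def by blast
  qed
qed

lemma compact_locally_path_connected_group:
  assumes G: "compact_group G T" and lpc: "locally_path_connected_space T"
  shows "finite (carrier (G Mod identity_component G T))"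
    and "G Mod identity_component G T = path_component_group G T"
    and "path_connectedin T (identity_component G T)"
    and "locally_path_connected_space (subtopology T (identity_component G T))"
proof -
  have top: "topological_group G T" and comp: "compact_space T"
    using G by (auto simp: compact_group_def)
  have ts: "topspace T = carrier G" using top by (simp add: topological_group_def)
  have ic: "identity_component G T = path_component_of_set T \<one>\<^bsub>G\<^esub>"
    by (simp add: identity_component_def path_component_eq_connected_component_of[OF lpc])
  have rc: "rcosets\<^bsub>G\<^esub> (identity_component G T) = path_components_of T"
    using path_component_set_rcoset[OF top]
    by (force simp: RCOSETS_def ic path_components_of_def ts)
  show eq: "G Mod identity_component G T = path_component_group G T"
    by (simp add: FactGroup_def path_component_group_def rc[unfolded ic] ic)
  show "finite (carrier (G Mod identity_component G T))"
    by (simp add: eq path_component_group_def finite_path_components_of_compact_space comp lpc)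
  show "path_connectedin T (identity_component G T)"
    by (simp add: ic path_connectedin_path_component_of)
  show "locally_path_connected_space (subtopology T (identity_component G T))"
    by (simp add: ic locally_path_connected_space_open_subset lpc
        openin_path_component_of_locally_path_connected_space)
qed

lemma locally_trivial_action_locally_path_connected:
  assumes triv: "locally_trivial_action G T X \<phi>"
    and lpc: "locally_path_connected_space X" and ne: "topspace X \<noteq> {}"
  shows "locally_path_connected_space T"
proof -
  let ?O = "orbit_space G X \<phi>"
  obtain x where x: "x \<in> topspace X" using ne by blast
  then have "orbit G \<phi> x \<in> topspace ?O" by (auto simp: topspace_orbit_space orbits_def)
  then obtain U h where U: "openin ?O U" "orbit G \<phi> x \<in> U"
    and h: "homeomorphic_map (subtopology X {x \<in> topspace X. orbit G \<phi> x \<in> U})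
          (prod_topology T (subtopology ?O U)) h"
    using triv unfolding locally_trivial_action_def by meson
  let ?V = "{x \<in> topspace X. orbit G \<phi> x \<in> U}"
  have "locally_path_connected_space (subtopology X ?V)"
    using U(1) lpc by (auto simp: openin_orbit_space intro: locally_path_connected_space_open_subset)
  then have "locally_path_connected_space (prod_topology T (subtopology ?O U))"
    using homeomorphic_locally_path_connected_space homeomorphic_map_imp_homeomorphic_space[OF h] by blast
  moreover have "h x \<in> topspace (prod_topology T (subtopology ?O U))"
    using homeomorphic_imp_surjective_map[OF h] x U(2) by auto
  then have "prod_topology T (subtopology ?O U) \<noteq> trivial_topology"
    by (metis empty_iff topspace_discrete_topology)
  ultimately show ?thesis by (simp add: locally_path_connected_space_prod_topology)
qed

theorem proposition1p4:
  fixes G :: "('a, 'm) monoid_scheme" and T :: "'a topology"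
    and R :: "('a \<Rightarrow> complex mat) set"
  assumes "compact_group G T"
    and "irrep_representatives G T R"
    and "principal_action G T (unitary_product_topology G R)
           (left_translation (unitary_product G R) (canonical_embedding R))"
  shows "(finite (carrier (G Mod identity_component G T)) \<and>
          finite (carrier (path_component_group G T)) \<and>
          G Mod identity_component G T = path_component_group G T) \<and>
         path_connectedin T (identity_component G T) \<and>
         (locally_connected_space T \<and> locally_path_connected_space T \<and>
          locally_connected_space (subtopology T (identity_component G T)) \<and>
          locally_path_connected_space (subtopology T (identity_component G T)))"
proof -
  have lpc: "locally_path_connected_space T"
    using assms(3) locally_path_connected_space_unitary_product topspace_unitary_product_nonempty
    unfolding principal_action_def by (blast intro: locally_trivial_action_locally_path_connected)
  note G = compact_locally_path_connected_group[OF assms(1) lpc]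
  show ?thesis
    using lpc G(1,3,4) G(1)[unfolded G(2)] G(2) locally_path_connected_imp_locally_connected_space by auto
qed

end
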